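(* Let $d\ge 1$ and let $n\ge4$ be an even integer. If $U\subseteq\mathbb{Z}^d$ is translation respecting and $|T_U|>1$, then exactly one of the following alternatives holds: [Type 1] if $U_1,U_2\in T_U$ and $U_1\ne U_2$ then $U_1\cap U_2=\emptyset$; [Type $-1$] if $U_1,U_2\in T_U$ and $U_1\neq U_2$ then $U_1^c\cap U_2^c=\emptyset$; [Type 0] if $U_1,U_2\in T_U$ then $U_1\subseteq U_2$ or $U_2\subseteq U_1$. Moreover, if $U$ satisfies the Type 0 alternative, then there exists a unique order-preserving bijection $o\colon T_U\to\mathbb{Z}$ such that $o(U)=0$, where order preserving means that $o(U_1)<o(U_2)$ if and only if $U_1\subsetneq U_2$. Furthermore, in this case there exists $\Delta\in n\mathbb{Z}^d$ such that $o^{-1}(i+1)=o^{-1}(i)+\Delta$ for all $i\in\mathbb{Z}$.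
   Context: $\mathbb{Z}^d$ is regarded as the nearest-neighbor graph of the integer lattice; complements are taken in $\mathbb{Z}^d$. A set $U\subseteq\mathbb{Z}^d$ is co-connected if $U\ne\emptyset$, $U\ne\mathbb{Z}^d$, and both $U$ and $U^c$ are connected. The boundary $\partial U$ is the set of edges having one endpoint in $U$ and one in $U^c$. Two sets $U_1,U_2$ are boundary disjoint if (i) $\partial U_1\cap\partial U_2=\emptyset$, and (ii) there is no $4$-cycle in $\mathbb{Z}^d$ with vertices, in cyclic order, $(v_{00},v_{01},v_{11},v_{10})$ such that $v_{00}\in U_1^c\cap U_2^c$, $v_{01}\in U_1^c\cap U_2$, $v_{11}\in U_1\cap U_2$, $v_{10}\in U_1\cap U_2^c$. For $U\subseteq\mathbb{Z}^d$, $T_U:=\{U+x: x\in n\mathbb{Z}^d\}$ (a set of sets), where $U+x=\{u+x:u\in U\}$. A set $U$ is translation respecting if $U$ is co-connected and every two distinct $U_1,U_2\in T_U$ are boundary disjoint. *)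

theory Defs
  imports "HOL-Analysis.Finite_Cartesian_Product" "HOL-Library.FuncSet"
begin

text \<open>
  The lattice of dimension \<open>d \<ge> 1\<close> is the type \<open>int ^ 'd\<close> with \<open>'d\<close> a finite type, so that
  \<open>d = CARD('d)\<close>. Being arbitrary, \<open>'d\<close> covers every \<open>d \<ge> 1\<close>. Complements are taken in this type.
\<close>

definition lattice_adj :: "int ^ 'd \<Rightarrow> int ^ 'd \<Rightarrow> bool" where
  "lattice_adj u v \<longleftrightarrow> (\<Sum>i\<in>UNIV. \<bar>u $ i - v $ i\<bar>) = 1"

text \<open>
  Connectedness of the induced subgraph: paths have to stay inside \<open>S\<close>. The empty set counts as
  connected; this is immaterial for \<open>co_connected\<close>.
\<close>

definition lattice_connected :: "(int ^ 'd) set \<Rightarrow> bool" where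
  "lattice_connected S \<longleftrightarrow>
    (\<forall>u\<in>S. \<forall>v\<in>S. (u, v) \<in> {(x, y). x \<in> S \<and> y \<in> S \<and> lattice_adj x y}\<^sup>*)"

definition co_connected :: "(int ^ 'd) set \<Rightarrow> bool" where
  "co_connected U \<longleftrightarrow>
    U \<noteq> {} \<and> U \<noteq> UNIV \<and> lattice_connected U \<and> lattice_connected (- U)"

definition edge_boundary :: "(int ^ 'd) set \<Rightarrow> (int ^ 'd) set set" where
  "edge_boundary U = {{u, v} | u v. lattice_adj u v \<and> u \<in> U \<and> v \<in> - U}"

definition four_cycle :: "int ^ 'd \<Rightarrow> int ^ 'd \<Rightarrow> int ^ 'd \<Rightarrow> int ^ 'd \<Rightarrow> bool" where
  "four_cycle a b c d \<longleftrightarrow> distinct [a, b, c, d] \<and>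
    lattice_adj a b \<and> lattice_adj b c \<and> lattice_adj c d \<and> lattice_adj d a"

definition boundary_disjoint :: "(int ^ 'd) set \<Rightarrow> (int ^ 'd) set \<Rightarrow> bool" where
  "boundary_disjoint U1 U2 \<longleftrightarrow>
    edge_boundary U1 \<inter> edge_boundary U2 = {} \<and>
    \<not> (\<exists>v00 v01 v11 v10. four_cycle v00 v01 v11 v10 \<and>
          v00 \<in> - U1 \<inter> - U2 \<and> v01 \<in> - U1 \<inter> U2 \<and>
          v11 \<in> U1 \<inter> U2 \<and> v10 \<in> U1 \<inter> - U2)"

definition scaled_lattice :: "nat \<Rightarrow> (int ^ 'd) set" where
  "scaled_lattice n = {x. \<forall>i. int n dvd x $ i}"

definition translate :: "int ^ 'd \<Rightarrow> (int ^ 'd) set \<Rightarrow> (int ^ 'd) set" where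
  "translate x U = (\<lambda>u. u + x) ` U"

definition translates :: "nat \<Rightarrow> (int ^ 'd) set \<Rightarrow> (int ^ 'd) set set" where
  "translates n U = {translate x U | x. x \<in> scaled_lattice n}"

definition translation_respecting :: "nat \<Rightarrow> (int ^ 'd) set \<Rightarrow> bool" where
  "translation_respecting n U \<longleftrightarrow> co_connected U \<and>
    (\<forall>U1\<in>translates n U. \<forall>U2\<in>translates n U. U1 \<noteq> U2 \<longrightarrow> boundary_disjoint U1 U2)"

definition type_pos :: "nat \<Rightarrow> (int ^ 'd) set \<Rightarrow> bool" where
  "type_pos n U \<longleftrightarrow>
    (\<forall>U1\<in>translates n U. \<forall>U2\<in>translates n U. U1 \<noteq> U2 \<longrightarrow> U1 \<inter> U2 = {})"

definition type_neg :: "nat \<Rightarrow> (int ^ 'd) set \<Rightarrow> bool" where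
  "type_neg n U \<longleftrightarrow>
    (\<forall>U1\<in>translates n U. \<forall>U2\<in>translates n U. U1 \<noteq> U2 \<longrightarrow> - U1 \<inter> - U2 = {})"

definition type_zero :: "nat \<Rightarrow> (int ^ 'd) set \<Rightarrow> bool" where
  "type_zero n U \<longleftrightarrow>
    (\<forall>U1\<in>translates n U. \<forall>U2\<in>translates n U. U1 \<subseteq> U2 \<or> U2 \<subseteq> U1)"

text \<open>
  A map with domain \<open>translates n U\<close> is a total HOL function that is \<open>undefined\<close> off this set
  (\<open>extensional\<close>). Without this condition, uniqueness would fail for irrelevant reasons.
\<close>

definition order_bijection ::
    "nat \<Rightarrow> (int ^ 'd) set \<Rightarrow> ((int ^ 'd) set \<Rightarrow> int) \<Rightarrow> bool" where
  "order_bijection n U f \<longleftrightarrow>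
    f \<in> extensional (translates n U) \<and> bij_betw f (translates n U) UNIV \<and>
    (\<forall>U1\<in>translates n U. \<forall>U2\<in>translates n U. f U1 < f U2 \<longleftrightarrow> U1 \<subset> U2) \<and>
    f U = 0"

end

theory Submission
  imports Defs
begin

text \<open>
  Two co-connected boundary disjoint sets \<open>A\<close>, \<open>B\<close> are nested, disjoint or jointly covering: condition
  (ii) says that the map sending a vertex to its quadrant (its membership in \<open>A\<close> and \<open>B\<close>), viewed as a
  map into a cycle of length 4, has winding number 0 around every lattice square, so it lifts to an
  integer height function \<open>H\<close>. Connectedness of \<open>A\<close>, \<open>- A\<close>, \<open>B\<close>, \<open>- B\<close> makes the difference between
  \<open>H\<close> and a branch of the quadrant constant on each of these sets; if all four quadrants were
  inhabited, going once around them would change \<open>H\<close> by 4.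

  Any two points are separated by only finitely many translates, since their boundaries are disjoint
  and a path between the points has finitely many edges. If \<open>U\<close> is disjoint from \<open>U + x\<close> and strictly
  contained in \<open>U + y\<close>, then for the last \<open>z = x + l y\<close> with \<open>U + z\<close> disjoint from \<open>U\<close> one gets
  \<open>U + z \<subseteq> - U \<subseteq> U + z + y\<close>, hence \<open>U + 2z + y \<subseteq> U \<subseteq> (- U) + z \<subseteq> U + 2z + y\<close>; thus \<open>U + z\<close> is the
  complement of \<open>U\<close> and has the same boundary, a contradiction. Complementation and composition of
  inclusions exclude the other mixtures of types. In type 0, the finiteness yields a smallest
  translate \<open>U + \<Delta>\<close> above \<open>U\<close>, and the translates are exactly \<open>U + k \<Delta>\<close> for integers \<open>k\<close>.
\<close>

subsection \<open>The lattice graph\<close>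

lemma lattice_adj_sym: "lattice_adj u v \<longleftrightarrow> lattice_adj v u"
  by (simp add: lattice_adj_def abs_minus_commute)

lemma lattice_adj_axis: "lattice_adj x (x + axis i 1)"
  by (simp add: lattice_adj_def axis_def if_distrib[of abs] cong: if_cong)

text \<open>Nonnegative integers with sum 1 have exactly one nonzero entry, so every edge is a unit
  step along an axis.\<close>

lemma lattice_adjE:
  fixes u v :: "int ^ 'd"
  assumes "lattice_adj u v"
  obtains i where "v = u + axis i 1" | i where "u = v + axis i 1"
proof -
  have total: "(\<Sum>j\<in>UNIV. \<bar>u $ j - v $ j\<bar>) = 1"
    using assms by (simp add: lattice_adj_def)
  then obtain i where i: "\<bar>u $ i - v $ i\<bar> \<noteq> 0"
    by (metis (no_types, lifting) sum.neutral zero_neq_one)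
  have split: "(\<Sum>j\<in>UNIV. \<bar>u $ j - v $ j\<bar>)
      = \<bar>u $ i - v $ i\<bar> + (\<Sum>j\<in>UNIV - {i}. \<bar>u $ j - v $ j\<bar>)"
    by (simp add: sum.remove)
  have "(\<Sum>j\<in>UNIV - {i}. \<bar>u $ j - v $ j\<bar>) \<ge> 0"
    by (simp add: sum_nonneg)
  with total split i have one: "\<bar>u $ i - v $ i\<bar> = 1"
    and "(\<Sum>j\<in>UNIV - {i}. \<bar>u $ j - v $ j\<bar>) = 0" by linarith+
  then have rest: "u $ j = v $ j" if "j \<noteq> i" for j
    using that by (subst (asm) sum_nonneg_eq_0_iff) auto
  from one consider "v $ i = u $ i + 1" | "u $ i = v $ i + 1" by linarith
  then show thesis
  proof cases
    case 1
    then have "v = u + axis i 1" using rest by (auto simp: vec_eq_iff axis_def)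
    then show thesis by (rule that)
  next
    case 2
    then have "u = v + axis i 1" using rest by (auto simp: vec_eq_iff axis_def)
    then show thesis by (rule that)
  qed
qed

text \<open>Induction on the l1 distance: a unit step in a coordinate where \<open>x\<close> and
  \<open>y\<close> differ reduces it.\<close>

lemma lattice_rtrancl_adj: "(x, y) \<in> {(u, v). lattice_adj u v}\<^sup>*"
proof (induction "nat (\<Sum>i\<in>UNIV. \<bar>x $ i - y $ i\<bar>)" arbitrary: x rule: less_induct)
  case less
  show ?case
  proof (cases "x = y")
    case False
    then obtain i where i: "x $ i \<noteq> y $ i" by (auto simp: vec_eq_iff)
    define z where "z = (if x $ i < y $ i then x + axis i 1 else x - axis i 1)"
    have adj: "lattice_adj x z"
      using lattice_adj_axis[of x i] lattice_adj_axis[of "x - axis i 1" i]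
      by (auto simp: z_def lattice_adj_sym)
    have dist: "(\<Sum>j\<in>UNIV. \<bar>w $ j - y $ j\<bar>)
        = \<bar>w $ i - y $ i\<bar> + (\<Sum>j\<in>UNIV - {i}. \<bar>w $ j - y $ j\<bar>)" for w
      by (simp add: sum.remove)
    have "(\<Sum>j\<in>UNIV - {i}. \<bar>z $ j - y $ j\<bar>) = (\<Sum>j\<in>UNIV - {i}. \<bar>x $ j - y $ j\<bar>)"
      by (rule sum.cong) (auto simp: z_def axis_def)
    moreover have "\<bar>z $ i - y $ i\<bar> < \<bar>x $ i - y $ i\<bar>"
      using i by (auto simp: z_def axis_def)
    moreover have "(\<Sum>j\<in>UNIV - {i}. \<bar>z $ j - y $ j\<bar>) \<ge> 0" by (simp add: sum_nonneg)
    ultimately have "nat (\<Sum>j\<in>UNIV. \<bar>z $ j - y $ j\<bar>) < nat (\<Sum>j\<in>UNIV. \<bar>x $ j - y $ j\<bar>)"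
      using dist[of z] dist[of x] by linarith
    then have "(z, y) \<in> {(u, v). lattice_adj u v}\<^sup>*" by (rule less)
    with adj show ?thesis by (auto intro: converse_rtrancl_into_rtrancl)
  qed simp
qed

lemma connected_constant:
  assumes "lattice_connected S" "u \<in> S" "v \<in> S"
    and step: "\<And>x y. x \<in> S \<Longrightarrow> y \<in> S \<Longrightarrow> lattice_adj x y \<Longrightarrow> k x = k y"
  shows "k u = k v"
proof -
  have "(u, v) \<in> {(x, y). x \<in> S \<and> y \<in> S \<and> lattice_adj x y}\<^sup>*"
    using assms unfolding lattice_connected_def by blast
  then show ?thesis by induction (use step in auto)
qed

lemma edge_boundary_mem:
  assumes "lattice_adj u v" "u \<in> A \<longleftrightarrow> v \<notin> A"
  shows "{u, v} \<in> edge_boundary A"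
  using assms lattice_adj_sym[of u v] insert_commute[of u v "{}"]
  unfolding edge_boundary_def by (cases "u \<in> A") (clarsimp, metis)+

text \<open>A path from a point of \<open>A\<close> to a point outside has to cross the
  boundary.\<close>

lemma edge_boundary_nonempty:
  assumes "A \<noteq> {}" "A \<noteq> UNIV"
  shows "edge_boundary A \<noteq> {}"
proof
  assume empty: "edge_boundary A = {}"
  obtain a b where "a \<in> A" "b \<notin> A" using assms by blast
  moreover have "a \<in> A \<longleftrightarrow> b \<in> A"
    using lattice_rtrancl_adj[of a b]
    by induction (use empty edge_boundary_mem in blast)+
  ultimately show False by blast
qed

lemma edge_boundary_Compl: "edge_boundary (- A) = edge_boundary A"
  unfolding edge_boundary_def
  by (auto simp: lattice_adj_sym insert_commute) (metis insert_commute lattice_adj_sym)+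

subsection \<open>Potentials of closed lattice forms\<close>

text \<open>The discrete integral from 0 to \<open>t\<close>; at least one of the two sums is empty,
  and the second covers negative \<open>t\<close>.\<close>

definition antidifference :: "(int \<Rightarrow> 'b::ab_group_add) \<Rightarrow> int \<Rightarrow> 'b" where
  "antidifference f t = sum f {0..<t} - sum f {t..<0}"

lemma antidifference_step: "antidifference f (t + 1) = antidifference f t + f t"
proof (cases "t \<ge> 0")
  case True
  then have "{0..<t + 1} = insert t {0..<t}" by auto
  with True show ?thesis by (simp add: antidifference_def add.commute)
next
  case False
  then have "{t..<0} = insert t {t + 1..<0}" by auto
  with False show ?thesis by (simp add: antidifference_def)
qed

text \<open>The discrete Poincare lemma: a form closed on all unit squares is exact. The potential
  is built one direction at a time.\<close>

lemma discrete_poincare: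
  fixes g :: "'d::finite \<Rightarrow> int ^ 'd \<Rightarrow> 'b::ab_group_add"
  assumes closed: "\<And>i j x. g i x + g j (x + axis i 1) = g j x + g i (x + axis j 1)"
  obtains H where "\<And>i x. H (x + axis i 1) = H x + g i x"
proof -
  have "finite S \<Longrightarrow> \<exists>H. \<forall>i\<in>S. \<forall>x. H (x + axis i 1) = H x + g i x" for S
  proof (induction S rule: finite_induct)
    case (insert j S)
    then obtain H where H: "\<And>i x. i \<in> S \<Longrightarrow> H (x + axis i 1) = H x + g i x" by blast
    \<comment> \<open>The error of \<open>H\<close> in the new direction \<open>j\<close>.
      Closedness makes it invariant along the old directions, so integrating it along
      \<open>j\<close> corrects \<open>H\<close> without disturbing them.\<close>
    define r where "r x = g j x - (H (x + axis j 1) - H x)" for x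
    have r: "r (x + axis i 1) = r x" if "i \<in> S" for i x
    proof -
      have "H (x + axis j 1 + axis i 1) = H (x + axis j 1) + g i (x + axis j 1)"
        and "H (x + axis i 1) = H x + g i x"
        using H that by auto
      moreover have "x + axis i 1 + axis j 1 = x + axis j 1 + axis i 1" 
        by (simp add: add_ac)
      ultimately show ?thesis using closed[of i x j] unfolding r_def
        by (simp add: algebra_simps)
    qed
    \<comment> \<open>\<open>put x\<close> parametrizes the line through \<open>x\<close> in
      direction \<open>j\<close>; \<open>K\<close> integrates \<open>r\<close> along it from the
      hyperplane where coordinate \<open>j\<close> is 0.\<close>
    define put where "put x t = (\<chi> i. if i = j then t else x $ i)" for x :: "int ^ 'd" and t
    define K where "K x = antidifference (\<lambda>t. r (put x t)) (x $ j)" for x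
    have put_j: "put (x + axis j 1) = put x" "put x (x $ j) = x" for x
      by (auto simp: put_def vec_eq_iff axis_def fun_eq_iff)
    have put_i: "put (x + axis i 1) t = put x t + axis i 1" if "i \<in> S" for x i t
      using that insert.hyps by (auto simp: put_def vec_eq_iff axis_def)
    have "K (x + axis j 1) = K x + r x" for x
      by (simp add: K_def put_j antidifference_step)
    moreover have "K (x + axis i 1) = K x" if "i \<in> S" for i x
    proof -
      have "(x + axis i 1) $ j = x $ j" using that insert.hyps by (auto simp: axis_def)
      with that show ?thesis by (simp add: K_def put_i r)
    qed
    ultimately have "\<forall>i\<in>insert j S. \<forall>x. H (x + axis i 1) + K (x + axis i 1) = H x + K x + g i x"
      using H by (auto simp: r_def algebra_simps)
    then show ?case by (intro exI[of _ "\<lambda>x. H x + K x"])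
  qed simp
  from this[of UNIV] that show thesis by auto
qed

subsection \<open>Boundary disjoint sets\<close>

text \<open>The numbering is cyclic: neighbours modulo 4 differ in one membership, and 0, 1, 2, 3 is
  the order of \<open>v00\<close>, \<open>v01\<close>, \<open>v11\<close>, \<open>v10\<close> in
  condition (ii).\<close>

definition quadrant :: "'a set \<Rightarrow> 'a set \<Rightarrow> 'a \<Rightarrow> int" where
  "quadrant A B v = (if v \<in> A then if v \<in> B then 2 else 3 else if v \<in> B then 1 else 0)"

text \<open>
  The signed step between cyclically adjacent quadrants. Opposite quadrants get the junk value 2;
  they are never joined by an edge when the boundaries are disjoint.
\<close>

definition turn :: "'a set \<Rightarrow> 'a set \<Rightarrow> 'a \<Rightarrow> 'a \<Rightarrow> int" where
  "turn A B u v = (quadrant A B v - quadrant A B u + 1) mod 4 - 1"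

lemma quadrant_cases:
  obtains "quadrant A B v = 0" | "quadrant A B v = 1" | "quadrant A B v = 2" | "quadrant A B v = 3"
  unfolding quadrant_def by (metis (full_types))

text \<open>An edge between opposite quadrants changes both memberships, so it would lie in both
  boundaries.\<close>

lemma quadrant_adj:
  assumes "boundary_disjoint A B" "lattice_adj u v"
  shows "\<bar>quadrant A B v - quadrant A B u\<bar> \<noteq> 2"
proof -
  have "edge_boundary A \<inter> edge_boundary B = {}"
    using assms by (simp add: boundary_disjoint_def)
  then have "\<not> ((u \<in> A \<longleftrightarrow> v \<notin> A) \<and> (u \<in> B \<longleftrightarrow> v \<notin> B))"
    using edge_boundary_mem[OF assms(2)] by blast
  then show ?thesis unfolding quadrant_def by (auto split: if_splits)
qed

lemma quadrant_four_cycle: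
  assumes "boundary_disjoint A B" "four_cycle a b c d"
  shows "\<not> (quadrant A B a = 0 \<and> quadrant A B b = 1 \<and> quadrant A B c = 2 \<and> quadrant A B d = 3)"
proof
  assume "quadrant A B a = 0 \<and> quadrant A B b = 1 \<and> quadrant A B c = 2 \<and> quadrant A B d = 3"
  then have "a \<in> - A \<inter> - B" "b \<in> - A \<inter> B" "c \<in> A \<inter> B" "d \<in> A \<inter> - B"
    unfolding quadrant_def by (auto split: if_splits)
  with assms show False unfolding boundary_disjoint_def by blast
qed

lemma four_cycle_rotate: "four_cycle a b c d \<Longrightarrow> four_cycle b c d a"
  unfolding four_cycle_def by auto

lemma four_cycle_reflect: "four_cycle a b c d \<Longrightarrow> four_cycle a d c b"
  unfolding four_cycle_def by (auto simp: lattice_adj_sym)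

text \<open>With steps in {-1, 0, 1}, the total turn around the cycle is a multiple of 4. It can be
  nonzero only if all four quadrants are visited in cyclic order, which condition (ii)
  forbids.\<close>

lemma turn_four_cycle:
  assumes bd: "boundary_disjoint A B" and cyc: "four_cycle a b c d"
  shows "turn A B a b + turn A B b c = turn A B a d + turn A B d c"
proof -
  \<comment> \<open>Condition (ii) fixes the starting quadrant and the orientation, so all rotations
    and reflections of the cycle are needed.\<close>
  have rot: "four_cycle a b c d" "four_cycle b c d a" "four_cycle c d a b" "four_cycle d a b c"
    using cyc four_cycle_rotate by blast+
  note no_cycle = rot[THEN quadrant_four_cycle[OF bd]]
    rot[THEN four_cycle_reflect, THEN quadrant_four_cycle[OF bd]]
  have adj: "lattice_adj a b" "lattice_adj b c" "lattice_adj a d" "lattice_adj d c"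
    using cyc by (simp_all add: four_cycle_def lattice_adj_sym)
  note no_diag = adj[THEN quadrant_adj[OF bd]]
  show ?thesis
    by (cases A B a rule: quadrant_cases; cases A B b rule: quadrant_cases;
        cases A B c rule: quadrant_cases; cases A B d rule: quadrant_cases)
      (use no_cycle no_diag in \<open>simp_all add: turn_def\<close>)
qed

lemma lattice_square:
  assumes "i \<noteq> j"
  shows "four_cycle x (x + axis i 1) (x + axis i 1 + axis j 1) (x + axis j 1)"
proof -
  have "axis i (1::int) $ i \<noteq> axis j 1 $ i" "axis i (1::int) $ i + axis j 1 $ i \<noteq> 0"
    "axis i (1::int) $ j + axis j 1 $ j \<noteq> 0"
    using assms by (simp_all add: axis_def)
  then have "axis i 1 \<noteq> axis j (1::int)" "axis i 1 + axis j (1::int) \<noteq> 0"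
    by (metis, metis vector_add_component zero_index)
  moreover have "lattice_adj x (x + axis i 1)"
    and "lattice_adj (x + axis i 1) (x + axis i 1 + axis j 1)"
    by (rule lattice_adj_axis)+
  moreover have "lattice_adj (x + axis j 1) x"
    using lattice_adj_axis[of x j] by (simp add: lattice_adj_sym)
  moreover have "lattice_adj (x + axis i 1 + axis j 1) (x + axis j 1)"
    using lattice_adj_axis[of "x + axis j 1" i]
    by (metis add.assoc add.commute lattice_adj_sym)
  ultimately show ?thesis
    unfolding four_cycle_def by (simp add: add.assoc)
qed

lemma turn_potential:
  assumes bd: "boundary_disjoint A B"
  obtains H where "\<And>u v. lattice_adj u v \<Longrightarrow> H v - H u = turn A B u v"
proof -
  have "turn A B x (x + axis i 1) + turn A B (x + axis i 1) (x + axis i 1 + axis j 1)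
      = turn A B x (x + axis j 1) + turn A B (x + axis j 1) (x + axis j 1 + axis i 1)" for i j x
  proof (cases "i = j")
    case False
    then show ?thesis
      using turn_four_cycle[OF bd lattice_square[of i j x]] by (simp add: add_ac)
  qed simp
  then obtain H where H: "\<And>i x. H (x + axis i 1) = H x + turn A B x (x + axis i 1)"
    using discrete_poincare[of "\<lambda>i x. turn A B x (x + axis i 1)"] by blast
  \<comment> \<open>\<open>H\<close> is so far controlled on positive unit steps only. Antisymmetry
    handles reversed edges; it would fail for the junk value 2, which \<open>quadrant_adj\<close>
    rules out.\<close>
  have flip: "turn A B u v = - turn A B v u" if "lattice_adj u v" for u v
    by (cases A B u rule: quadrant_cases; cases A B v rule: quadrant_cases)
      (use quadrant_adj[OF bd that] in \<open>simp_all add: turn_def\<close>)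
  show thesis
  proof (rule that)
    fix u v :: "int ^ 'a"
    assume "lattice_adj u v"
    with H flip[OF this] show "H v - H u = turn A B u v"
      by (elim lattice_adjE) (auto simp: algebra_simps)
  qed
qed

lemma boundary_disjoint_cases:
  assumes A: "co_connected A" and B: "co_connected B" and bd: "boundary_disjoint A B"
  shows "A \<subseteq> B \<or> B \<subseteq> A \<or> A \<inter> B = {} \<or> A \<union> B = UNIV"
proof (rule ccontr)
  assume "\<not> ?thesis"
  then obtain a b c d where pts: "a \<in> A" "a \<in> B" "b \<in> A" "b \<notin> B" "c \<notin> A" "c \<in> B"
    "d \<notin> A" "d \<notin> B" by blast
  obtain H where H: "\<And>u v. lattice_adj u v \<Longrightarrow> H v - H u = turn A B u v"
    using turn_potential[OF bd] by blast
  have conn: "lattice_connected A" "lattice_connected (- A)"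
    "lattice_connected B" "lattice_connected (- B)"
    using A B by (simp_all add: co_connected_def)
  \<comment> \<open>On \<open>A\<close>, \<open>- A\<close> and \<open>B\<close> the quadrant values
    are {2, 3}, {0, 1} and {1, 2}: no wrap-around occurs and the turn is the plain
    difference.\<close>
  have "H x - quadrant A B x = H y - quadrant A B y"
    if "lattice_adj x y" "x \<in> A \<and> y \<in> A \<or> x \<notin> A \<and> y \<notin> A \<or> x \<in> B \<and> y \<in> B" for x y
    using H[OF that(1)] that(2) by (simp add: turn_def quadrant_def split: if_splits)
  then have "H a - quadrant A B a = H b - quadrant A B b"
    and "H c - quadrant A B c = H d - quadrant A B d"
    and "H a - quadrant A B a = H c - quadrant A B c"
    using pts connected_constant[OF conn(1), of a b "\<lambda>v. H v - quadrant A B v"]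
      connected_constant[OF conn(2), of c d "\<lambda>v. H v - quadrant A B v"]
      connected_constant[OF conn(3), of a c "\<lambda>v. H v - quadrant A B v"]
    by simp_all
  \<comment> \<open>On \<open>- B\<close> the values 3 and 0 are adjacent, so the branch has to use \<open>- 1\<close> in place of 3.\<close>
  moreover have "H x - (if x \<in> A then - 1 else 0) = H y - (if y \<in> A then - 1 else 0)"
    if "lattice_adj x y" "x \<notin> B" "y \<notin> B" for x y
    using H[OF that(1)] that(2,3) by (simp add: turn_def quadrant_def split: if_splits)
  then have "H b - (if b \<in> A then - 1 else 0) = H d - (if d \<in> A then - 1 else 0)"
    using pts connected_constant[OF conn(4), of b d "\<lambda>v. H v - (if v \<in> A then - 1 else 0)"] by simp
  \<comment> \<open>The first three equalities give \<open>H b - H d = 3\<close>, the last one gives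
    \<open>H b - H d = - 1\<close>.\<close>
  ultimately show False using pts by (simp add: quadrant_def)
qed


section \<open>Finiteness of the family of sets separating two points\<close>

lemma finite_separating:
  assumes disjoint: "\<And>V W. V \<in> F \<Longrightarrow> W \<in> F \<Longrightarrow> V \<noteq> W \<Longrightarrow> edge_boundary V \<inter> edge_boundary W = {}"
  shows "finite {V \<in> F. p \<in> V \<and> q \<notin> V}"
  using lattice_rtrancl_adj[of p q]
proof induction
  case (step y z)
  have "lattice_adj y z" using step.hyps by simp
  \<comment> \<open>The edge from \<open>y\<close> to \<open>z\<close> lies in the boundary of at
    most one member of \<open>F\<close>, so extending the path by it adds at most one separating
    set.\<close>
  then have "V = W" if "V \<in> F" "y \<in> V" "z \<notin> V" "W \<in> F" "y \<in> W" "z \<notin> W" for V W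
    using disjoint[of V W] edge_boundary_mem[of y z] that by blast
  then obtain X where "{V \<in> F. y \<in> V \<and> z \<notin> V} \<subseteq> {X}" by blast
  then have "finite {V \<in> F. y \<in> V \<and> z \<notin> V}" by (rule finite_subset) simp
  with step.IH have "finite ({V \<in> F. p \<in> V \<and> y \<notin> V} \<union> {V \<in> F. y \<in> V \<and> z \<notin> V})"
    by simp
  then show ?case by (rule rev_finite_subset) blast
qed simp

subsection \<open>Translates\<close>

lemma mem_translate: "v \<in> translate x U \<longleftrightarrow> v - x \<in> U"
  by (auto simp: translate_def image_iff intro: bexI[of _ "v - x"])

lemma translate_zero [simp]: "translate 0 U = U"
  by (auto simp: mem_translate)

lemma translate_translate [simp]: "translate x (translate y U) = translate (x + y) U"
  by (auto simp: mem_translate diff_diff_eq add.commute)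

lemma translate_Compl: "translate x (- U) = - translate x U"
  by (auto simp: mem_translate)

lemma translate_Int: "translate x (A \<inter> B) = translate x A \<inter> translate x B"
  by (auto simp: mem_translate)

lemma translate_subset_iff: "translate x A \<subseteq> translate x B \<longleftrightarrow> A \<subseteq> B"
  unfolding translate_def by (rule inj_image_subset_iff) simp

lemma translate_psubset_iff: "translate x A \<subset> translate x B \<longleftrightarrow> A \<subset> B"
  by (simp add: less_le_not_le translate_subset_iff)

lemma translate_empty_iff [simp]: "translate x A = {} \<longleftrightarrow> A = {}"
  by (simp add: translate_def)

lemma translate_UNIV [simp]: "translate x UNIV = UNIV"
  by (auto simp: mem_translate)

lemma translate_eq_iff: "translate x A = translate x B \<longleftrightarrow> A = B"
  unfolding translate_def by (rule inj_image_eq_iff) simp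

lemma lattice_connected_translate:
  assumes "lattice_connected S"
  shows "lattice_connected (translate x S)"
  unfolding lattice_connected_def translate_def
proof (clarify)
  fix u v
  assume "u \<in> S" "v \<in> S"
  then have "(u, v) \<in> {(a, b). a \<in> S \<and> b \<in> S \<and> lattice_adj a b}\<^sup>*"
    using assms by (simp add: lattice_connected_def)
  then show "(u + x, v + x) \<in> {(a, b). a \<in> (\<lambda>u. u + x) ` S \<and> b \<in> (\<lambda>u. u + x) ` S \<and> lattice_adj a b}\<^sup>*"
  proof induction
    case (step y z)
    then have "(y + x, z + x) \<in> {(a, b). a \<in> (\<lambda>u. u + x) ` S \<and> b \<in> (\<lambda>u. u + x) ` S \<and> lattice_adj a b}"
      by (auto simp: lattice_adj_def)
    with step.IH show ?case by (rule rtrancl_into_rtrancl)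
  qed simp
qed

lemma co_connected_translate: "co_connected U \<Longrightarrow> co_connected (translate x U)"
  using lattice_connected_translate[of U x] lattice_connected_translate[of "- U" x]
    translate_eq_iff[of x U UNIV]
  by (simp add: co_connected_def translate_Compl)

lemma scaled_lattice_zero [simp]: "0 \<in> scaled_lattice n"
  by (simp add: scaled_lattice_def)

lemma scaled_lattice_add: "x \<in> scaled_lattice n \<Longrightarrow> y \<in> scaled_lattice n \<Longrightarrow> x + y \<in> scaled_lattice n"
  by (simp add: scaled_lattice_def)

lemma scaled_lattice_diff: "x \<in> scaled_lattice n \<Longrightarrow> y \<in> scaled_lattice n \<Longrightarrow> x - y \<in> scaled_lattice n"
  by (simp add: scaled_lattice_def)

lemma scaled_lattice_smult: "x \<in> scaled_lattice n \<Longrightarrow> k *s x \<in> scaled_lattice n"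
  by (simp add: scaled_lattice_def)

lemma translatesI: "x \<in> scaled_lattice n \<Longrightarrow> translate x U \<in> translates n U"
  by (auto simp: translates_def)

lemma translatesE:
  assumes "V \<in> translates n U"
  obtains x where "x \<in> scaled_lattice n" "V = translate x U"
  using assms by (auto simp: translates_def)

lemma translates_refl: "U \<in> translates n U"
  using translatesI[of 0] by simp

lemma translate_translates:
  assumes "x \<in> scaled_lattice n" "V \<in> translates n U"
  shows "translate x V \<in> translates n U"
  using assms by (auto elim!: translatesE intro!: translatesI scaled_lattice_add)

lemma translates_Compl: "translates n (- U) = uminus ` translates n U"
  by (auto simp: translates_def translate_Compl image_iff)

section \<open>Complementation and the relative position of two translates\<close>

lemma boundary_disjoint_Compl:
  assumes "boundary_disjoint A B"
  shows "boundary_disjoint (- A) (- B)"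
proof -
  \<comment> \<open>Complementing both sets exchanges opposite quadrants, so a forbidden cycle
    becomes one for \<open>A\<close> and \<open>B\<close> after rotation by two.\<close>
  have False if "four_cycle a b c d" "a \<in> A \<inter> B" "b \<in> A \<inter> - B" "c \<in> - A \<inter> - B" "d \<in> - A \<inter> B"
    for a b c d
    using assms that four_cycle_rotate[OF four_cycle_rotate[OF that(1)]]
    unfolding boundary_disjoint_def by blast
  with assms show ?thesis
    unfolding boundary_disjoint_def edge_boundary_Compl double_complement by blast
qed

lemma translation_respecting_Compl:
  assumes "translation_respecting n U"
  shows "translation_respecting n (- U)"
  using assms
  by (auto simp: translation_respecting_def co_connected_def translates_Compl
      intro!: boundary_disjoint_Compl)

lemma translates_co_connected:
  assumes "translation_respecting n U" "V \<in> translates n U"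
  shows "co_connected V"
  using assms by (auto simp: translation_respecting_def elim!: translatesE intro: co_connected_translate)

lemma translates_boundary_disjoint:
  assumes "translation_respecting n U" "V \<in> translates n U" "W \<in> translates n U" "V \<noteq> W"
  shows "boundary_disjoint V W"
  using assms by (simp add: translation_respecting_def)

lemma translates_cases:
  assumes "translation_respecting n U" "V \<in> translates n U" "W \<in> translates n U"
  shows "V \<subseteq> W \<or> W \<subseteq> V \<or> V \<inter> W = {} \<or> V \<union> W = UNIV"
  using boundary_disjoint_cases[of V W] translates_co_connected[OF assms(1)]
    translates_boundary_disjoint[OF assms] assms by blast

lemma translates_not_Compl:
  assumes "translation_respecting n U" "V \<in> translates n U" "W \<in> translates n U"
  shows "V \<noteq> - W"
proof
  assume eq: "V = - W"
  then have "boundary_disjoint V W"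
    using translates_boundary_disjoint[OF assms] by blast
  then have "edge_boundary W = {}"
    by (simp add: eq boundary_disjoint_def edge_boundary_Compl)
  then show False
    using edge_boundary_nonempty[of W] translates_co_connected[OF assms(1,3)]
    by (simp add: co_connected_def)
qed

lemma finite_separating_translates:
  assumes "translation_respecting n U"
  shows "finite {V \<in> translates n U. p \<in> V \<and> q \<notin> V}"
  using translates_boundary_disjoint[OF assms]
  by (intro finite_separating) (simp add: boundary_disjoint_def)

section \<open>Incompatibility of disjoint, covering and strictly nested pairs\<close>

lemma strict_mono_translate_smult:
  assumes "U \<subset> translate y U"
  shows "strict_mono (\<lambda>k::int. translate (x + k *s y) U)"
proof (rule strict_monoI)
  fix j k :: int
  have succ: "translate (x + k *s y) U \<subset> translate (x + (k + 1) *s y) U" for k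
  proof -
    have "translate (x + k *s y) U \<subset> translate (x + k *s y) (translate y U)"
      using assms by (simp only: translate_psubset_iff)
    then show ?thesis by (simp add: vector_sadd_rdistrib add.assoc)
  qed
  assume "j < k"
  then show "translate (x + j *s y) U \<subset> translate (x + k *s y) U"
    by (induction k rule: int_gr_induct) (rule succ, metis succ psubset_trans)
qed

lemma disjoint_translate_not_increasing:
  assumes tr: "translation_respecting n U"
    and x: "x \<in> scaled_lattice n" and y: "y \<in> scaled_lattice n"
    and disjoint: "U \<inter> translate x U = {}" and increasing: "U \<subset> translate y U"
  shows False
proof -
  define C where "C k = translate (x + int k *s y) U" for k
  have C_mono: "strict_mono C"
    using strict_mono_translate_smult[OF increasing, of x]
    by (auto simp: C_def strict_mono_def)
  have C_in: "C k \<in> translates n U" for k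
    unfolding C_def by (intro translatesI scaled_lattice_add scaled_lattice_smult x y)
  have co: "co_connected U" using tr by (simp add: translation_respecting_def)
  then obtain q where q: "q \<in> U" by (auto simp: co_connected_def)
  have "translate x U \<subseteq> C k" for k
    using strict_mono_mono[OF C_mono, THEN monoD, of 0 k] by (simp add: C_def)
  with q have p: "q + x \<in> C k" for k
    using mem_translate[of "q + x" x U] by auto
  \<comment> \<open>Otherwise infinitely many translates \<open>C k\<close> would contain
    \<open>q + x\<close> but not \<open>q\<close>.\<close>
  have "\<exists>k. U \<inter> C k \<noteq> {}"
  proof (rule ccontr)
    assume "\<not> ?thesis"
    then have "range C \<subseteq> {V \<in> translates n U. q + x \<in> V \<and> q \<notin> V}"
      using C_in p q by blast
    then have "finite (range C)"
      using finite_separating_translates[OF tr] by (rule finite_subset)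
    then show False
      using finite_imageD strict_mono_imp_inj_on[OF C_mono] by blast
  qed
  define m where "m = (LEAST k. U \<inter> C k \<noteq> {})"
  have meets: "U \<inter> C m \<noteq> {}" unfolding m_def by (rule LeastI_ex) fact
  moreover have "U \<inter> C 0 = {}" using disjoint by (simp add: C_def)
  ultimately obtain l where l: "m = Suc l" by (cases m) auto
  define z where "z = x + int l *s y"
  have z: "translate z U = C l" by (simp add: z_def C_def)
  have zy: "translate (z + y) U = C m"
    by (simp add: z_def C_def l vector_sadd_rdistrib add_ac)
  have apart: "U \<inter> C l = {}"
    using not_less_Least[of l "\<lambda>k. U \<inter> C k \<noteq> {}"] by (simp add: m_def[symmetric] l)
  have "U \<union> C m = UNIV"
  proof -
    have sub: "C l \<subseteq> C m" using strict_mono_mono[OF C_mono] by (simp add: l mono_def)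
    have "\<not> C m \<subseteq> U" using sub p apart by blast
    \<comment> \<open>Shifting such an inclusion by \<open>- y\<close> would put
      \<open>translate (- y) U\<close> inside both \<open>C l\<close> and \<open>U\<close>, which
      are disjoint.\<close>
    moreover have "\<not> U \<subseteq> C m"
    proof
      assume "U \<subseteq> C m"
      then have "translate (- y) U \<subseteq> translate (- y) (translate (z + y) U)"
        by (simp only: translate_subset_iff zy)
      then have "translate (- y) U \<subseteq> C l" by (simp add: z)
      moreover have "translate (- y) U \<subseteq> U"
        using increasing translate_subset_iff[of "- y" U "translate y U"] by simp
      ultimately have "translate (- y) U = {}" using apart by blast
      then show False using q by simp
    qed
    ultimately show ?thesis
      using translates_cases[OF tr translates_refl C_in, of m] meets by blast
  qed
  then have lower: "translate z U \<subseteq> - U" and upper: "- U \<subseteq> translate (z + y) U"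
    using apart by (auto simp: z zy)
  have "translate (z + y + z) U \<subseteq> translate (z + y) (- U)"
    using translate_subset_iff[of "z + y" "translate z U" "- U"] lower by simp
  also have "\<dots> \<subseteq> U" using upper by (auto simp: translate_Compl)
  finally have "translate (z + y + z) U \<subseteq> U" .
  moreover have "translate z (- U) \<subseteq> translate (z + y + z) U"
    using translate_subset_iff[of z "- U" "translate (z + y) U"] upper by (simp add: add_ac)
  moreover have "U \<subseteq> translate z (- U)" using lower by (auto simp: translate_Compl)
  ultimately have "U = - translate z U" by (auto simp: translate_Compl)
  then show False using translates_not_Compl[OF tr translates_refl C_in] z by metis
qed

text \<open>Both relations are translation invariant, so the first set of each pair can be moved to
  \<open>U\<close>.\<close>

lemma translates_disjoint_not_psubset:
  assumes tr: "translation_respecting n U"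
    and in_T: "V \<in> translates n U" "W \<in> translates n U" "V' \<in> translates n U" "W' \<in> translates n U"
    and "V \<inter> W = {}" "V' \<subset> W'"
  shows False
proof -
  obtain a b c d where abcd: "a \<in> scaled_lattice n" "b \<in> scaled_lattice n"
      "c \<in> scaled_lattice n" "d \<in> scaled_lattice n"
    and eqs: "V = translate a U" "W = translate b U" "V' = translate c U" "W' = translate d U"
    using in_T by (auto elim!: translatesE)
  have "translate a (U \<inter> translate (b - a) U) = {}"
    using assms(6) by (simp add: translate_Int eqs)
  moreover have "translate c U \<subset> translate c (translate (d - c) U)"
    using assms(7) by (simp add: eqs)
  ultimately show False
    using disjoint_translate_not_increasing[OF tr, of "b - a" "d - c"]
    by (simp add: translate_psubset_iff scaled_lattice_diff abcd del: translate_translate)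
qed

text \<open>Complements turn covering pairs into disjoint ones and reverse strict inclusion.\<close>

lemma translates_cover_not_psubset:
  assumes tr: "translation_respecting n U"
    and in_T: "V \<in> translates n U" "W \<in> translates n U" "V' \<in> translates n U" "W' \<in> translates n U"
    and "V \<union> W = UNIV" "V' \<subset> W'"
  shows False
  by (rule translates_disjoint_not_psubset[OF translation_respecting_Compl[OF tr],
        of "- V" "- W" "- W'" "- V'"])
    (use assms in \<open>auto simp: translates_Compl\<close>)

lemma translates_disjoint_not_cover:
  assumes tr: "translation_respecting n U"
    and in_T: "V \<in> translates n U" "W \<in> translates n U" "V' \<in> translates n U" "W' \<in> translates n U"
    and disjoint: "V \<inter> W = {}" and cover: "V' \<union> W' = UNIV"
  shows False
proof -
  obtain a b where ab: "a \<in> scaled_lattice n" "b \<in> scaled_lattice n"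
    and eqs: "V = translate a U" "V' = translate b U"
    using in_T by (auto elim!: translatesE)
  \<comment> \<open>The shift takes \<open>V\<close> to \<open>V'\<close>, hence
    \<open>W1 \<subseteq> - V' \<subseteq> W'\<close>. Equality of \<open>W1\<close> and
    \<open>W'\<close> would make \<open>V'\<close> the complement of a translate, so the inclusion
    is strict.\<close>
  define W1 where "W1 = translate (b - a) W"
  have W1: "W1 \<in> translates n U"
    unfolding W1_def using ab in_T by (intro translate_translates scaled_lattice_diff)
  have "translate (b - a) (V \<inter> W) = V' \<inter> W1"
    by (simp add: translate_Int eqs W1_def)
  then have "V' \<inter> W1 = {}" using disjoint by (metis translate_empty_iff)
  then have "W1 \<subset> W'"
    using cover translates_not_Compl[OF tr in_T(3) W1] by blast
  then show False
    using translates_disjoint_not_psubset[OF tr in_T(1,2) W1 in_T(4) disjoint] by blast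
qed

section \<open>Existence and uniqueness of the type\<close>

lemma translates_type_exists:
  assumes tr: "translation_respecting n U"
  shows "type_pos n U \<or> type_neg n U \<or> type_zero n U"
proof (cases "\<exists>V\<in>translates n U. \<exists>W\<in>translates n U. V \<subset> W")
  case True
  then obtain V' W' where chain: "V' \<in> translates n U" "W' \<in> translates n U" "V' \<subset> W'"
    by blast
  have "V \<subseteq> W \<or> W \<subseteq> V" if VW: "V \<in> translates n U" "W \<in> translates n U" for V W
    using translates_cases[OF tr VW] translates_disjoint_not_psubset[OF tr VW chain(1,2) _ chain(3)]
      translates_cover_not_psubset[OF tr VW chain(1,2) _ chain(3)] by argo
  then show ?thesis by (simp add: type_zero_def)
next
  case False
  then have alt: "V \<inter> W = {} \<or> V \<union> W = UNIV"
    if "V \<in> translates n U" "W \<in> translates n U" "V \<noteq> W" for V W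
    using translates_cases[OF tr that(1,2)] that by (metis psubsetI)
  show ?thesis
  proof (cases "type_pos n U")
    case False
    \<comment> \<open>A pair violating type 1 is covering by \<open>alt\<close>, and one covering
      pair excludes every disjoint pair.\<close>
    then obtain V' W' where V'W': "V' \<in> translates n U" "W' \<in> translates n U" "V' \<union> W' = UNIV"
      unfolding type_pos_def using alt by metis
    have "- V \<inter> - W = {}" if VW: "V \<in> translates n U" "W \<in> translates n U" "V \<noteq> W" for V W
    proof -
      have "V \<union> W = UNIV"
        using alt[OF VW] translates_disjoint_not_cover[OF tr VW(1,2) V'W'(1,2) _ V'W'(3)] by argo
      then show ?thesis by auto
    qed
    then show ?thesis by (simp add: type_neg_def)
  qed simp
qed

text \<open>One pair of distinct translates decides: disjoint and covering means complementary,
  nested and disjoint forces an empty set, nested and covering forces the whole lattice.\<close>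

lemma translates_type_unique:
  assumes tr: "translation_respecting n U"
    and VW: "V \<in> translates n U" "W \<in> translates n U" "V \<noteq> W"
  shows "\<not> (type_pos n U \<and> type_neg n U)" "\<not> (type_pos n U \<and> type_zero n U)"
    "\<not> (type_neg n U \<and> type_zero n U)"
proof -
  have proper: "V \<noteq> {}" "W \<noteq> {}" "V \<noteq> UNIV" "W \<noteq> UNIV"
    using translates_co_connected[OF tr] VW by (auto simp: co_connected_def)
  have pos: "V \<inter> W = {}" if "type_pos n U" using that VW by (simp add: type_pos_def)
  have neg: "- V \<inter> - W = {}" if "type_neg n U" using that VW by (simp add: type_neg_def)
  have zero: "V \<subseteq> W \<or> W \<subseteq> V" if "type_zero n U" using that VW by (simp add: type_zero_def)
  have "V = - W" if "V \<inter> W = {}" "- V \<inter> - W = {}" using that by blast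
  then show "\<not> (type_pos n U \<and> type_neg n U)"
    using pos neg translates_not_Compl[OF tr VW(1,2)] by argo
  show "\<not> (type_pos n U \<and> type_zero n U)" using pos zero proper by blast
  show "\<not> (type_neg n U \<and> type_zero n U)" using neg zero proper by blast
qed

text \<open>All \<open>c k\<close> with \<open>k\<close> in \<open>K\<close> would separate a point
  of \<open>A\<close> from a point outside \<open>B\<close>, and they are pairwise distinct.\<close>

lemma infinite_strict_chain:
  assumes tr: "translation_respecting n U" and c: "strict_mono (c :: int \<Rightarrow> _)"
    and T: "range c \<subseteq> translates n U" and K: "infinite K"
    and "A \<noteq> {}" "B \<noteq> UNIV" "\<And>k. k \<in> K \<Longrightarrow> A \<subseteq> c k" "\<And>k. k \<in> K \<Longrightarrow> c k \<subseteq> B"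
  shows False
proof -
  obtain p q where "p \<in> A" "q \<notin> B" using assms(5,6) by blast
  then have "c ` K \<subseteq> {V \<in> translates n U. p \<in> V \<and> q \<notin> V}"
    using T assms(7,8) by blast
  then have "finite (c ` K)" using finite_separating_translates[OF tr] by (rule finite_subset)
  then show False
    using finite_imageD[of c K] inj_on_subset[OF strict_mono_imp_inj_on[OF c] subset_UNIV] K by blast
qed

subsection \<open>Type 0\<close>

text \<open>The last property says that \<open>translate D V\<close> is the immediate successor of
  \<open>V\<close>. It is found at \<open>U\<close>, as a minimal element of a finite interval above
  \<open>U\<close>, and carried to \<open>V\<close> by translation.\<close>

lemma type_zero_generator:
  assumes tr: "translation_respecting n U" and zero: "type_zero n U"
    and ne: "\<exists>V\<in>translates n U. \<exists>W\<in>translates n U. V \<noteq> W"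
  obtains D where "D \<in> scaled_lattice n" "U \<subset> translate D U"
    "\<And>V W. V \<in> translates n U \<Longrightarrow> W \<in> translates n U \<Longrightarrow> V \<subset> W \<Longrightarrow> \<not> W \<subset> translate D V"
proof -
  obtain V W where VW: "V \<in> translates n U" "W \<in> translates n U" "V \<noteq> W"
    using ne by blast
  then have "V \<subseteq> W \<or> W \<subseteq> V" using zero by (simp add: type_zero_def)
  then have "V \<subset> W \<or> W \<subset> V" using VW(3) by auto
  then obtain V' W' where "V' \<in> translates n U" "W' \<in> translates n U" "V' \<subset> W'"
    using VW by metis
  then obtain a b where ab: "a \<in> scaled_lattice n" "b \<in> scaled_lattice n"
      "translate a U \<subset> translate b U"
    by (auto elim!: translatesE)
  define X where "X = translate (b - a) U"
  have X: "X \<in> translates n U" unfolding X_def by (intro translatesI scaled_lattice_diff ab)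
  have "U \<subset> X"
    using ab(3) translate_psubset_iff[of a U X] by (simp add: X_def)
  define S where "S = {V \<in> translates n U. U \<subset> V \<and> V \<subseteq> X}"
  have "U \<noteq> {}" "X \<noteq> UNIV"
    using tr translates_co_connected[OF tr X]
    by (simp_all add: co_connected_def translation_respecting_def)
  then obtain p q where pq: "p \<in> U" "q \<notin> X" by blast
  have "finite S"
    using finite_separating_translates[OF tr, of p q]
    by (rule rev_finite_subset) (use pq in \<open>auto simp: S_def\<close>)
  moreover have "X \<in> S" using X \<open>U \<subset> X\<close> by (simp add: S_def)
  ultimately obtain M where M: "M \<in> S" "\<And>V. V \<in> S \<Longrightarrow> V \<subseteq> M \<Longrightarrow> M = V"
    using finite_has_minimal[of S] by blast
  then obtain D where D: "D \<in> scaled_lattice n" "M = translate D U"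
    by (auto simp: S_def elim!: translatesE)
  show thesis
  proof
    show "U \<subset> translate D U" using M(1) D by (simp add: S_def)
    fix V W assume V: "V \<in> translates n U" and W: "W \<in> translates n U" and "V \<subset> W"
    obtain x where x: "x \<in> scaled_lattice n" "V = translate x U" using V by (rule translatesE)
    have "translate (- x) W \<in> translates n U"
      using translate_translates[OF scaled_lattice_diff[OF scaled_lattice_zero x(1)] W] by simp
    moreover have "U \<subset> translate (- x) W"
      using \<open>V \<subset> W\<close> translate_psubset_iff[of "- x" V W] x by simp
    ultimately have "translate (- x) W \<in> S" if "translate (- x) W \<subset> M"
      using that M(1) by (auto simp: S_def)
    then have "\<not> translate (- x) W \<subset> M" using M(2) by blast
    moreover have "translate (- x) (translate D V) = M" by (simp add: x D)
    ultimately show "\<not> W \<subset> translate D V" by (metis translate_psubset_iff)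
  qed fact
qed

lemma type_zero_enumeration:
  assumes tr: "translation_respecting n U" and zero: "type_zero n U"
    and D: "D \<in> scaled_lattice n" "U \<subset> translate D U"
    and cover: "\<And>V W. V \<in> translates n U \<Longrightarrow> W \<in> translates n U \<Longrightarrow> V \<subset> W \<Longrightarrow> \<not> W \<subset> translate D V"
  shows "range (\<lambda>k. translate (k *s D) U) = translates n U"
proof
  define c where "c k = translate (k *s D) U" for k
  have c_mono: "strict_mono c"
    using strict_mono_translate_smult[OF D(2), of 0] by (simp add: c_def[abs_def])
  have c_in: "c k \<in> translates n U" for k
    unfolding c_def by (intro translatesI scaled_lattice_smult D)
  show "range (\<lambda>k. translate (k *s D) U) \<subseteq> translates n U" using c_in by (auto simp: c_def)
  have "W \<in> range c" if W: "W \<in> translates n U" for W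
  proof -
    have proper: "V \<noteq> {}" "V \<noteq> UNIV" if "V \<in> translates n U" for V
      using translates_co_connected[OF tr that] by (auto simp: co_connected_def)
    have total: "c k \<subseteq> W \<or> W \<subseteq> c k" for k
      using zero c_in W by (simp add: type_zero_def)
    have c_le: "c j \<subseteq> c k" if "j \<le> k" for j k
      using strict_mono_mono[OF c_mono] that by (simp add: mono_def)
    have c_range: "range c \<subseteq> translates n U" using c_in by auto
    \<comment> \<open>Otherwise all \<open>c k\<close> with \<open>k \<le> 0\<close> lie between
      \<open>W\<close> and \<open>c 0\<close>. Dually, the chain cannot stay below \<open>W\<close>
      forever.\<close>
    obtain a where a: "c a \<subseteq> W"
    proof (rule ccontr)
      assume "\<not> thesis"
      then have "W \<subseteq> c k" for k using that total by metis
      then show False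
        using infinite_strict_chain[OF tr c_mono c_range infinite_Iic[of 0], of W "c 0"] c_le
          proper(1)[OF W] proper(2)[OF c_in] by simp
    qed
    have "\<exists>b\<ge>a. W \<subseteq> c b"
    proof (rule ccontr)
      assume "\<not> ?thesis"
      then have "c k \<subseteq> W" if "k \<ge> a" for k using that total by metis
      then show False
        using infinite_strict_chain[OF tr c_mono c_range infinite_Ici[of a], of "c a" W] c_le
          proper(1)[OF c_in] proper(2)[OF W] by simp
    qed
    then have "\<exists>m. W \<subseteq> c (a + int m)" by (metis zle_iff_zadd)
    \<comment> \<open>For \<open>m = 0\<close> this yields \<open>W = c a\<close>. Otherwise
      \<open>W\<close> lies strictly above \<open>c (a + int l)\<close> and below its immediate
      successor, hence equals the latter.\<close>
    define m where "m = (LEAST m. W \<subseteq> c (a + int m))"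
    have upper: "W \<subseteq> c (a + int m)" unfolding m_def by (rule LeastI_ex) fact
    show ?thesis
    proof (cases m)
      case 0
      then show ?thesis using a upper by auto
    next
      case (Suc l)
      have "\<not> W \<subseteq> c (a + int l)"
        using not_less_Least[of l "\<lambda>m. W \<subseteq> c (a + int m)"] Suc by (simp add: m_def[symmetric])
      then have "c (a + int l) \<subset> W" using total by blast
      moreover have "c (a + int m) = translate D (c (a + int l))"
        by (simp add: c_def Suc vector_sadd_rdistrib add_ac)
      ultimately show ?thesis using cover[OF c_in W] upper by blast
    qed
  qed
  then show "translates n U \<subseteq> range (\<lambda>k. translate (k *s D) U)" by (auto simp: c_def)
qed

section \<open>Order bijections onto the integers\<close>

lemma order_bijection_succ:
  assumes f: "order_bijection n U f"
    and D: "D \<in> scaled_lattice n" "U \<subset> translate D U"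
    and cover: "\<And>V W. V \<in> translates n U \<Longrightarrow> W \<in> translates n U \<Longrightarrow> V \<subset> W \<Longrightarrow> \<not> W \<subset> translate D V"
    and V: "V \<in> translates n U"
  shows "f (translate D V) = f V + 1"
proof -
  have less: "f X < f Y \<longleftrightarrow> X \<subset> Y" if "X \<in> translates n U" "Y \<in> translates n U" for X Y
    using f that by (simp add: order_bijection_def)
  \<comment> \<open>Surjectivity supplies the translate \<open>W\<close> of value
    \<open>f V + 1\<close>; a larger value at \<open>translate D V\<close> would place
    \<open>W\<close> strictly in between.\<close>
  have "f V + 1 \<in> f ` translates n U"
    using f by (simp add: order_bijection_def bij_betw_def)
  then obtain W where W: "W \<in> translates n U" "f W = f V + 1" by auto
  have DV: "translate D V \<in> translates n U" using D V by (intro translate_translates)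
  obtain x where x: "V = translate x U" using V by (rule translatesE)
  have "V \<subset> translate D V"
    using D(2) translate_psubset_iff[of x U "translate D U"] by (simp add: x add.commute)
  then have "f V < f (translate D V)" using less[OF V DV] by simp
  moreover have "V \<subset> W" using less[OF V W(1)] W(2) by simp
  then have "\<not> f W < f (translate D V)" using cover[OF V W(1)] less[OF W(1) DV] by simp
  ultimately show ?thesis using W(2) by linarith
qed

text \<open>Two-sided induction from \<open>f U = 0\<close>. As every translate has this form, it
  yields uniqueness.\<close>

lemma order_bijection_smult:
  assumes f: "order_bijection n U f"
    and D: "D \<in> scaled_lattice n" "U \<subset> translate D U"
    and cover: "\<And>V W. V \<in> translates n U \<Longrightarrow> W \<in> translates n U \<Longrightarrow> V \<subset> W \<Longrightarrow> \<not> W \<subset> translate D V"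
  shows "f (translate (k *s D) U) = k"
proof -
  have succ: "f (translate ((k + 1) *s D) U) = f (translate (k *s D) U) + 1" for k
    using order_bijection_succ[OF f D cover translatesI[OF scaled_lattice_smult[OF D(1)]], of k]
    by (simp add: vector_sadd_rdistrib add_ac)
  show ?thesis
  proof (induction k rule: int_induct[of _ 0])
    case base
    show ?case using f by (simp add: order_bijection_def)
  next
    case (step2 k)
    then show ?case using succ[of "k - 1"] by simp
  qed (simp add: succ)
qed

lemma type_zero_order_bijection:
  assumes tr: "translation_respecting n U" and zero: "type_zero n U"
    and D: "D \<in> scaled_lattice n" "U \<subset> translate D U"
    and cover: "\<And>V W. V \<in> translates n U \<Longrightarrow> W \<in> translates n U \<Longrightarrow> V \<subset> W \<Longrightarrow> \<not> W \<subset> translate D V"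
  shows "\<exists>!f. order_bijection n U f"
proof
  define c where "c k = translate (k *s D) U" for k
  have c_mono: "strict_mono c"
    using strict_mono_translate_smult[OF D(2), of 0] by (simp add: c_def[abs_def])
  have range: "translates n U = range c"
    using type_zero_enumeration[OF assms] by (simp add: c_def[abs_def])
  \<comment> \<open>The inverse of the enumeration; the restriction makes it extensional.\<close>
  define o' where "o' = restrict (inv c) (translates n U)"
  have o'_c: "o' (c k) = k" for k
    using strict_mono_imp_inj_on[OF c_mono] by (simp add: o'_def range)
  have "bij_betw o' (range c) UNIV"
    by (rule bij_betw_byWitness[where f' = c]) (auto simp: o'_c)
  moreover have "c 0 = U" by (simp add: c_def)
  ultimately show "order_bijection n U o'"
    using o'_c o'_c[of 0] strict_mono_less[OF c_mono]
    by (auto simp: order_bijection_def range o'_def[unfolded range] simp del: restrict_apply)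
  show "f = o'" if "order_bijection n U f" for f
  proof (rule extensionalityI[of _ "translates n U"])
    show "f \<in> extensional (translates n U)" using that by (simp add: order_bijection_def)
    show "o' \<in> extensional (translates n U)" by (simp add: o'_def)
    fix V assume "V \<in> translates n U"
    then obtain k where "V = c k" by (auto simp: range)
    then show "f V = o' V" using order_bijection_smult[OF that D cover] o'_c by (simp add: c_def)
  qed
qed

lemma order_bijection_inv_succ:
  assumes f: "order_bijection n U f"
    and D: "D \<in> scaled_lattice n" "U \<subset> translate D U"
    and cover: "\<And>V W. V \<in> translates n U \<Longrightarrow> W \<in> translates n U \<Longrightarrow> V \<subset> W \<Longrightarrow> \<not> W \<subset> translate D V"
  shows "inv_into (translates n U) f (i + 1) = translate D (inv_into (translates n U) f i)"
proof (rule inv_into_f_eq)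
  have bij: "bij_betw f (translates n U) UNIV" using f by (simp add: order_bijection_def)
  then show "inj_on f (translates n U)" by (rule bij_betw_imp_inj_on)
  have V: "inv_into (translates n U) f i \<in> translates n U" "f (inv_into (translates n U) f i) = i"
    using bij by (auto simp: bij_betw_def intro!: inv_into_into f_inv_into_f)
  then show "translate D (inv_into (translates n U) f i) \<in> translates n U"
    using D by (intro translate_translates)
  show "f (translate D (inv_into (translates n U) f i)) = i + 1"
    using order_bijection_succ[OF f D cover V(1)] V(2) by simp
qed

theorem theorem3p4:
  fixes U :: "(int ^ 'd) set" and n :: nat
  assumes "n \<ge> 4" and "even n"
    and "translation_respecting n U"
    and "\<exists>U1\<in>translates n U. \<exists>U2\<in>translates n U. U1 \<noteq> U2"
  shows "((type_pos n U \<and> \<not> type_neg n U \<and> \<not> type_zero n U) \<or>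
          (\<not> type_pos n U \<and> type_neg n U \<and> \<not> type_zero n U) \<or>
          (\<not> type_pos n U \<and> \<not> type_neg n U \<and> type_zero n U)) \<and>
         (type_zero n U \<longrightarrow>
           (\<exists>!f. order_bijection n U f) \<and>
           (\<forall>f. order_bijection n U f \<longrightarrow>
             (\<exists>\<Delta>\<in>scaled_lattice n. \<forall>i.
               inv_into (translates n U) f (i + 1) =
               translate \<Delta> (inv_into (translates n U) f i))))"
proof (intro conjI impI allI)
  obtain V W where "V \<in> translates n U" "W \<in> translates n U" "V \<noteq> W"
    using assms(4) by blast
  from translates_type_unique[OF assms(3) this] translates_type_exists[OF assms(3)]
  show "(type_pos n U \<and> \<not> type_neg n U \<and> \<not> type_zero n U) \<or>
        (\<not> type_pos n U \<and> type_neg n U \<and> \<not> type_zero n U) \<or>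
        (\<not> type_pos n U \<and> \<not> type_neg n U \<and> type_zero n U)"
    by blast
  assume zero: "type_zero n U"
  obtain D where D: "D \<in> scaled_lattice n" "U \<subset> translate D U"
    "\<And>V W. V \<in> translates n U \<Longrightarrow> W \<in> translates n U \<Longrightarrow> V \<subset> W \<Longrightarrow> \<not> W \<subset> translate D V"
    using type_zero_generator[OF assms(3) zero assms(4)] by blast
  show "\<exists>!f. order_bijection n U f"
    by (rule type_zero_order_bijection[OF assms(3) zero D])
  show "\<exists>\<Delta>\<in>scaled_lattice n. \<forall>i. inv_into (translates n U) f (i + 1) =
      translate \<Delta> (inv_into (translates n U) f i)" if "order_bijection n U f" for f
    using order_bijection_inv_succ[OF that D] D(1) by blast
qed

end
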